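(* Consider the following procedure. Input: a clause $C = L \lor C'$ (the candidate) and a clause $D = N_1 \lor \dots \lor N_n \lor D'$ (the partner), variable disjoint, without equality, where $N_1,\dots,N_n$ are exactly the literals of $D$ each of which is unifiable with $\bar L$. For $k = 1,\dots,n$: set $N := \{N_k\}$; while $L$ is unifiable with all literals in $\bar N = \{\bar M \mid M \in N\}$ via a most general unifier $\sigma$: let $K$ be the set of all pairs of complementary literals in the $L$-resolvent $C'\sigma \lor (D \setminus N)\sigma$; if $K = \emptyset$, return NO; if every pair in $K$ contains a literal of the form $N_i\sigma$, set $N := N \cup \{N_i \mid N_i\sigma \text{ is part of a complementary pair in } K\}$; otherwise leave the while loop. After the for loop, return YES. Then this procedure returns YES if and only if all $L$-resolvents of $C$ with $D$ are valid.
   Context: First-order logic without equality. A literal is an atom or a negated atom; $\bar L$ denotes the complement of $L$. Clauses are disjunctions of literals (multisets), with implicitly universally quantified variables. A clause (without equality) is valid iff it contains a pair of complementary literals. $L$-resolvent: given clauses $C = L \lor C'$ and $D = M_1 \lor \dots \lor M_l \lor D''$ with $l > 0$ (variable disjoint) such that $L, \bar M_1, \dots, \bar M_l$ are unifiable with most general unifier $\sigma$, the clause $C'\sigma \lor D''\sigma$ is an $L$-resolvent of $C$ and $D$.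
   Formalization: The test "every pair in K contains a literal of the form N_iσ" is taken only over N_i not yet in N; with any N_i the loop can run forever, e.g. for C = P(x) ∨ ¬P(a), L = P(x), D = ¬P(a) ∨ P(a), although all L-resolvents are valid. *)

theory Defs
  imports Main "HOL-Library.Multiset"
begin

datatype ('f, 'v) trm = Var 'v | Fun 'f "('f, 'v) trm list"

datatype ('p, 'f, 'v) atom = Atom 'p "('f, 'v) trm list"

datatype ('p, 'f, 'v) literal = Pos "('p, 'f, 'v) atom" | Neg "('p, 'f, 'v) atom"

type_synonym ('p, 'f, 'v) clause = "('p, 'f, 'v) literal multiset"

type_synonym ('f, 'v) subst = "'v \<Rightarrow> ('f, 'v) trm"

fun complement :: "('p, 'f, 'v) literal \<Rightarrow> ('p, 'f, 'v) literal" where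
  "complement (Pos A) = Neg A"
| "complement (Neg A) = Pos A"

fun vars_atom :: "('p, 'f, 'v) atom \<Rightarrow> 'v set" where
  "vars_atom (Atom p ts) = (\<Union>t \<in> set ts. set2_trm t)"

fun vars_lit :: "('p, 'f, 'v) literal \<Rightarrow> 'v set" where
  "vars_lit (Pos A) = vars_atom A"
| "vars_lit (Neg A) = vars_atom A"

definition vars_clause :: "('p, 'f, 'v) clause \<Rightarrow> 'v set" where
  "vars_clause C = (\<Union>M \<in> set_mset C. vars_lit M)"

subsection \<open>Substitutions and unification\<close>

primrec subst_trm :: "('f, 'v) trm \<Rightarrow> ('f, 'v) subst \<Rightarrow> ('f, 'v) trm" where
  "subst_trm (Var x) \<sigma> = \<sigma> x"
| "subst_trm (Fun f ts) \<sigma> = Fun f (map (\<lambda>t. subst_trm t \<sigma>) ts)"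

fun subst_atom :: "('p, 'f, 'v) atom \<Rightarrow> ('f, 'v) subst \<Rightarrow> ('p, 'f, 'v) atom" where
  "subst_atom (Atom p ts) \<sigma> = Atom p (map (\<lambda>t. subst_trm t \<sigma>) ts)"

fun subst_lit :: "('p, 'f, 'v) literal \<Rightarrow> ('f, 'v) subst \<Rightarrow> ('p, 'f, 'v) literal" where
  "subst_lit (Pos A) \<sigma> = Pos (subst_atom A \<sigma>)"
| "subst_lit (Neg A) \<sigma> = Neg (subst_atom A \<sigma>)"

definition subst_clause :: "('p, 'f, 'v) clause \<Rightarrow> ('f, 'v) subst \<Rightarrow> ('p, 'f, 'v) clause" where
  "subst_clause C \<sigma> = image_mset (\<lambda>M. subst_lit M \<sigma>) C"

definition is_unifier :: "('f, 'v) subst \<Rightarrow> ('p, 'f, 'v) literal set \<Rightarrow> bool" where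
  "is_unifier \<sigma> S \<longleftrightarrow> (\<forall>M \<in> S. \<forall>M' \<in> S. subst_lit M \<sigma> = subst_lit M' \<sigma>)"

definition unifiable :: "('p, 'f, 'v) literal set \<Rightarrow> bool" where
  "unifiable S \<longleftrightarrow> (\<exists>\<sigma>. is_unifier \<sigma> S)"

definition is_mgu :: "('f, 'v) subst \<Rightarrow> ('p, 'f, 'v) literal set \<Rightarrow> bool" where
  "is_mgu \<sigma> S \<longleftrightarrow> is_unifier \<sigma> S \<and>
     (\<forall>\<tau>. is_unifier \<tau> S \<longrightarrow> (\<exists>\<rho>. \<forall>x. \<tau> x = subst_trm (\<sigma> x) \<rho>))"

text \<open>Most general unifiers are unique only up to renaming; a selection function fixes which
  one an algorithm works with.\<close>

definition mgu_selection :: "(('p, 'f, 'v) literal set \<Rightarrow> ('f, 'v) subst) \<Rightarrow> bool" where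
  "mgu_selection mgu \<longleftrightarrow> (\<forall>S. (\<exists>\<sigma>. is_mgu \<sigma> S) \<longrightarrow> is_mgu (mgu S) S)"

subsection \<open>Validity\<close>

primrec eval_trm :: "('f \<Rightarrow> 'u list \<Rightarrow> 'u) \<Rightarrow> ('v \<Rightarrow> 'u) \<Rightarrow> ('f, 'v) trm \<Rightarrow> 'u" where
  "eval_trm F e (Var x) = e x"
| "eval_trm F e (Fun f ts) = F f (map (eval_trm F e) ts)"

fun true_atom ::
  "('f \<Rightarrow> 'u list \<Rightarrow> 'u) \<Rightarrow> ('p \<Rightarrow> 'u list \<Rightarrow> bool) \<Rightarrow> ('v \<Rightarrow> 'u) \<Rightarrow> ('p, 'f, 'v) atom \<Rightarrow> bool" where
  "true_atom F P e (Atom p ts) \<longleftrightarrow> P p (map (eval_trm F e) ts)"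

fun true_lit ::
  "('f \<Rightarrow> 'u list \<Rightarrow> 'u) \<Rightarrow> ('p \<Rightarrow> 'u list \<Rightarrow> bool) \<Rightarrow> ('v \<Rightarrow> 'u) \<Rightarrow> ('p, 'f, 'v) literal \<Rightarrow> bool" where
  "true_lit F P e (Pos A) \<longleftrightarrow> true_atom F P e A"
| "true_lit F P e (Neg A) \<longleftrightarrow> \<not> true_atom F P e A"

definition true_clause ::
  "('f \<Rightarrow> 'u list \<Rightarrow> 'u) \<Rightarrow> ('p \<Rightarrow> 'u list \<Rightarrow> bool) \<Rightarrow> ('p, 'f, 'v) clause \<Rightarrow> bool" where
  "true_clause F P C \<longleftrightarrow> (\<forall>e. \<exists>M \<in># C. true_lit F P e M)"

text \<open>HOL cannot quantify over universe types inside a definition, so the universe is fixed to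
  the type of terms. This is no restriction: by \<open>valid_true_clause\<close> below, a clause that is valid
  in this sense is true in every interpretation over every universe type.\<close>

definition valid :: "('p, 'f, 'v) clause \<Rightarrow> bool" where
  "valid C \<longleftrightarrow>
     (\<forall>(F :: 'f \<Rightarrow> ('f, 'v) trm list \<Rightarrow> ('f, 'v) trm) P. true_clause F P C)"

lemma complementary_pair_true_clause:
  assumes "M \<in># C" and "complement M \<in># C"
  shows "true_clause F P C"
proof -
  have "true_lit F P e M \<or> true_lit F P e (complement M)" for e
    by (cases M) auto
  with assms show ?thesis
    unfolding true_clause_def by blast
qed

lemma eval_trm_Fun_Var: "eval_trm Fun Var t = t"
  by (induction t) (auto simp: map_idI)

lemma valid_iff_complementary_pair:
  "valid C \<longleftrightarrow> (\<exists>M. M \<in># C \<and> complement M \<in># C)"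
proof
  assume v: "valid C"
  define P where "P = (\<lambda>p ts. Neg (Atom p ts) \<in># C)"
  have "true_clause Fun P C"
    using v unfolding valid_def by blast
  then obtain M where M: "M \<in># C" "true_lit Fun P Var M"
    unfolding true_clause_def by blast
  have P: "true_atom Fun P Var A \<longleftrightarrow> Neg A \<in># C" for A
    by (cases A) (simp add: P_def eval_trm_Fun_Var[abs_def])
  have "complement M \<in># C"
    using M by (cases M) (auto simp: P)
  with M show "\<exists>M. M \<in># C \<and> complement M \<in># C"
    by blast
qed (auto simp: valid_def intro: complementary_pair_true_clause)

lemma valid_true_clause:
  fixes F :: "'f \<Rightarrow> 'u list \<Rightarrow> 'u"
  assumes "valid C"
  shows "true_clause F P C"
  using assms complementary_pair_true_clause valid_iff_complementary_pair by blast

subsection \<open>Resolvents\<close>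

definition L_resolvent ::
  "('p, 'f, 'v) literal \<Rightarrow> ('p, 'f, 'v) clause \<Rightarrow> ('p, 'f, 'v) clause \<Rightarrow> ('p, 'f, 'v) clause \<Rightarrow> bool" where
  "L_resolvent L C D R \<longleftrightarrow>
     (\<exists>C' M D'' \<sigma>. C = add_mset L C' \<and> D = M + D'' \<and> M \<noteq> {#} \<and>
        is_mgu \<sigma> (insert L (complement ` set_mset M)) \<and>
        R = subst_clause C' \<sigma> + subst_clause D'' \<sigma>)"

definition complementary_pairs :: "('p, 'f, 'v) clause \<Rightarrow> ('p, 'f, 'v) literal set set" where
  "complementary_pairs R = {{M, complement M} | M. M \<in># R \<and> complement M \<in># R}"

subsection \<open>The procedure\<close>

datatype answer = YES | NO

datatype loop_exit = Return_NO | Leave_Loop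

text \<open>The while loop on the set \<open>N\<close>; the value \<open>None\<close> means that it does not terminate. A literal
  of a pair counts as being of the form \<open>N\<^sub>i\<sigma>\<close> if it is an instance of some \<open>N\<^sub>i\<close> that is still
  present in \<open>D \ N\<close>. Admitting \<open>N\<^sub>i \<in> N\<close> would let the loop run forever, for instance
  on \<open>C = P(x) \<or> \<not>P(a)\<close> with \<open>L = P(x)\<close> and \<open>D = \<not>P(a) \<or> P(a)\<close>.\<close>

partial_function (option) while_loop ::
  "(('p, 'f, 'v) literal set \<Rightarrow> ('f, 'v) subst) \<Rightarrow> ('p, 'f, 'v) literal \<Rightarrow> ('p, 'f, 'v) clause \<Rightarrow>
   ('p, 'f, 'v) literal list \<Rightarrow> ('p, 'f, 'v) clause \<Rightarrow> ('p, 'f, 'v) literal set \<Rightarrow> loop_exit option"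
where
  "while_loop mgu L C' Ns D N =
     (if unifiable (insert L (complement ` N)) then
        let \<sigma> = mgu (insert L (complement ` N));
            K = complementary_pairs (subst_clause C' \<sigma> + subst_clause {#M \<in># D. M \<notin> N#} \<sigma>)
        in if K = {} then Some Return_NO
           else if \<forall>p \<in> K. \<exists>M \<in> set Ns - N. subst_lit M \<sigma> \<in> p then
             while_loop mgu L C' Ns D (N \<union> {M \<in> set Ns. \<exists>p \<in> K. subst_lit M \<sigma> \<in> p})
           else Some Leave_Loop
      else Some Leave_Loop)"

fun for_loop ::
  "(('p, 'f, 'v) literal set \<Rightarrow> ('f, 'v) subst) \<Rightarrow> ('p, 'f, 'v) literal \<Rightarrow> ('p, 'f, 'v) clause \<Rightarrow>
   ('p, 'f, 'v) literal list \<Rightarrow> ('p, 'f, 'v) clause \<Rightarrow> ('p, 'f, 'v) literal list \<Rightarrow> answer option"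
where
  "for_loop mgu L C' Ns D [] = Some YES"
| "for_loop mgu L C' Ns D (N\<^sub>k # Ms) =
     (case while_loop mgu L C' Ns D {N\<^sub>k} of
        None \<Rightarrow> None
      | Some Return_NO \<Rightarrow> Some NO
      | Some Leave_Loop \<Rightarrow> for_loop mgu L C' Ns D Ms)"

text \<open>Candidate \<open>L \<or> C'\<close>, partner \<open>D\<close> whose literals unifiable with the complement of \<open>L\<close>
  are listed in \<open>Ns\<close>.\<close>

definition procedure ::
  "(('p, 'f, 'v) literal set \<Rightarrow> ('f, 'v) subst) \<Rightarrow> ('p, 'f, 'v) literal \<Rightarrow> ('p, 'f, 'v) clause \<Rightarrow>
   ('p, 'f, 'v) literal list \<Rightarrow> ('p, 'f, 'v) clause \<Rightarrow> answer option"
where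
  "procedure mgu L C' Ns D = for_loop mgu L C' Ns D Ns"

end

theory Submission imports Defs begin

text \<open>
  Literals unifiable with the complement of \<open>L\<close> all have the polarity opposite to that of \<open>L\<close>,
  so a complementary pair never consists of two of them. Suppose resolving on a sub-multiset \<open>M\<close>
  of \<open>D\<close> gives an invalid resolvent. A loop started on a literal of \<open>M\<close> keeps \<open>N \<subseteq> M\<close>: the
  unifier of \<open>M\<close> factors through that of \<open>N\<close>, so each complementary pair of the resolvent on \<open>N\<close>
  survives the instantiation and must be destroyed by removing its member of polarity opposite to
  \<open>L\<close>, which forces every literal added to \<open>N\<close> to lie in \<open>M\<close>. Hence the loop can only stop by
  returning NO. It does stop, since \<open>N\<close> grows strictly inside the finite set of the \<open>N\<^sub>i\<close>.
\<close>

section \<open>Existence of most general unifiers\<close>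

definition unifies_eqs :: "('f, 'v) subst \<Rightarrow> (('f, 'v) trm \<times> ('f, 'v) trm) list \<Rightarrow> bool" where
  "unifies_eqs \<sigma> E \<longleftrightarrow> (\<forall>(s, t) \<in> set E. subst_trm s \<sigma> = subst_trm t \<sigma>)"

definition is_mgu_eqs :: "('f, 'v) subst \<Rightarrow> (('f, 'v) trm \<times> ('f, 'v) trm) list \<Rightarrow> bool" where
  "is_mgu_eqs \<sigma> E \<longleftrightarrow> unifies_eqs \<sigma> E \<and>
     (\<forall>\<tau>. unifies_eqs \<tau> E \<longrightarrow> (\<exists>\<rho>. \<forall>x. \<tau> x = subst_trm (\<sigma> x) \<rho>))"

definition vars_eqs :: "(('f, 'v) trm \<times> ('f, 'v) trm) list \<Rightarrow> 'v set" where
  "vars_eqs E = (\<Union>(s, t) \<in> set E. set2_trm s \<union> set2_trm t)"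

lemma unifies_eqs_Nil [simp]: "unifies_eqs \<sigma> []"
  and unifies_eqs_Cons [simp]:
    "unifies_eqs \<sigma> ((s, t) # E) \<longleftrightarrow> subst_trm s \<sigma> = subst_trm t \<sigma> \<and> unifies_eqs \<sigma> E"
  and unifies_eqs_append [simp]:
    "unifies_eqs \<sigma> (E @ E') \<longleftrightarrow> unifies_eqs \<sigma> E \<and> unifies_eqs \<sigma> E'"
  by (auto simp: unifies_eqs_def)

lemma vars_eqs_Cons [simp]: "vars_eqs ((s, t) # E) = set2_trm s \<union> set2_trm t \<union> vars_eqs E"
  and vars_eqs_append [simp]: "vars_eqs (E @ E') = vars_eqs E \<union> vars_eqs E'"
  by (auto simp: vars_eqs_def)

lemma is_mgu_eqs_cong:
  assumes "\<And>\<tau>. unifies_eqs \<tau> E \<longleftrightarrow> unifies_eqs \<tau> E'"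
  shows "is_mgu_eqs \<sigma> E \<longleftrightarrow> is_mgu_eqs \<sigma> E'"
  using assms by (simp add: is_mgu_eqs_def)

lemma finite_vars_trm [simp]: "finite (set2_trm (t :: ('f, 'v) trm))"
  by (induction t) auto

lemma finite_vars_eqs [simp]: "finite (vars_eqs E)"
  by (auto simp: vars_eqs_def)

section \<open>Composition of substitutions and the occurs check\<close>

lemma subst_trm_subst_trm: "subst_trm (subst_trm t \<sigma>) \<tau> = subst_trm t (\<lambda>x. subst_trm (\<sigma> x) \<tau>)"
  by (induction t) auto

lemma subst_trm_cong:
  "(\<And>x. x \<in> set2_trm t \<Longrightarrow> \<sigma> x = \<tau> x) \<Longrightarrow> subst_trm t \<sigma> = subst_trm t \<tau>"
  by (induction t) auto

lemma subst_trm_Var [simp]: "subst_trm t Var = t"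
  by (induction t) (auto simp: map_idI)

lemma vars_subst_trm: "set2_trm (subst_trm t \<sigma>) = (\<Union>x \<in> set2_trm t. set2_trm (\<sigma> x))"
  by (induction t) auto

lemma size_occurring_var:
  "x \<in> set2_trm t \<Longrightarrow> size (\<sigma> x) \<le> size (subst_trm t \<sigma>)"
proof (induction t)
  case (Fun f ts)
  then obtain t where t: "t \<in> set ts" "size (\<sigma> x) \<le> size (subst_trm t \<sigma>)"
    by auto
  then have "size (subst_trm t \<sigma>) \<le> size_list size (map (\<lambda>t. subst_trm t \<sigma>) ts)"
    by (intro size_list_estimation'[of "subst_trm t \<sigma>"]) auto
  with t show ?case by simp
qed simp

text \<open>If \<open>x\<close> lay strictly below a function symbol of \<open>t\<close>, the
  instance of \<open>t\<close> would be strictly larger than its own subterm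
  \<open>\<sigma> x\<close>.\<close>

lemma occurs_check:
  assumes "x \<in> set2_trm t" and "\<sigma> x = subst_trm t \<sigma>"
  shows "t = Var x"
proof (cases t)
  case (Fun f ts)
  with assms obtain s where s: "s \<in> set ts" "x \<in> set2_trm s"
    by auto
  have "size (subst_trm s \<sigma>) \<le> size_list size (map (\<lambda>t. subst_trm t \<sigma>) ts)"
    using s by (intro size_list_estimation'[of "subst_trm s \<sigma>"]) auto
  with size_occurring_var[OF s(2), of \<sigma>] have "size (\<sigma> x) < size (subst_trm t \<sigma>)"
    using Fun by simp
  with assms show ?thesis by simp
qed (use assms in simp)

section \<open>Term unification by elimination, deletion and decomposition\<close>

lemma unifies_eqs_zip:
  "length ts = length us \<Longrightarrow>
   unifies_eqs \<sigma> (zip ts us) \<longleftrightarrow> map (\<lambda>t. subst_trm t \<sigma>) ts = map (\<lambda>t. subst_trm t \<sigma>) us"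
  by (induction ts us rule: list_induct2) auto

lemma vars_eqs_zip_subset:
  "vars_eqs (zip ts us) \<subseteq> (\<Union>t \<in> set ts. set2_trm t) \<union> (\<Union>t \<in> set us. set2_trm t)"
  by (auto simp: vars_eqs_def dest: set_zip_leftD set_zip_rightD)

lemma size_list_zip_fst:
  "length ts = length us \<Longrightarrow> size_list (\<lambda>e. size (fst e)) (zip ts us) = size_list size ts"
  by (induction ts us rule: list_induct2) auto

text \<open>Lexicographic induction on the number of variables and the total size of the left-hand
  sides. Eliminating a variable lowers the first; deleting a trivial equation or decomposing one
  lowers the second without raising the first.\<close>

lemma exists_mgu_eqs:
  assumes "unifies_eqs \<tau> E"
  shows "\<exists>\<sigma>. is_mgu_eqs \<sigma> E"
  using assms
proof (induction E arbitrary: \<tau> rule: wf_induct_rule[OF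
    wf_measures[of "[\<lambda>E. card (vars_eqs E), size_list (\<lambda>e. size (fst e))]"]])
  case (1 E)
  note IH = "1.IH" and uni = "1.prems"
  \<comment> \<open>Elimination: bind \<open>x\<close> to \<open>t\<close> by
    \<open>\<delta>\<close>, which removes \<open>x\<close> from the remaining equations, solve
    these by \<open>\<sigma>\<close>, and compose. The equivalence \<open>eq\<close> lets the
    equation for \<open>x\<close> stand either way round in \<open>E\<close>.\<close>
  have elim: "\<exists>\<sigma>. is_mgu_eqs \<sigma> E"
    if x: "x \<notin> set2_trm t" and xE: "vars_eqs ((Var x, t) # E') \<subseteq> vars_eqs E"
      and eq: "\<And>\<upsilon>. unifies_eqs \<upsilon> E \<longleftrightarrow> unifies_eqs \<upsilon> ((Var x, t) # E')" for x t E'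
  proof -
    define \<delta> where "\<delta> = Var(x := t)"
    define E'' where "E'' = map (\<lambda>(s, u). (subst_trm s \<delta>, subst_trm u \<delta>)) E'"
    have uni'': "unifies_eqs \<upsilon> E'' \<longleftrightarrow> unifies_eqs (\<lambda>y. subst_trm (\<delta> y) \<upsilon>) E'" for \<upsilon>
      by (auto simp: unifies_eqs_def E''_def subst_trm_subst_trm)
    \<comment> \<open>A unifier of \<open>x\<close> and \<open>t\<close> absorbs
      \<open>\<delta>\<close>; hence it unifies \<open>E''\<close> exactly if it unifies
      \<open>E'\<close>, and it factors through the composition.\<close>
    have \<delta>: "(\<lambda>y. subst_trm (\<delta> y) \<upsilon>) = \<upsilon>" if "\<upsilon> x = subst_trm t \<upsilon>" for \<upsilon>
      using that by (auto simp: \<delta>_def)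
    have sub: "set2_trm (subst_trm s \<delta>) \<subseteq> set2_trm s \<union> set2_trm t - {x}" for s
      using x by (auto simp: vars_subst_trm \<delta>_def split: if_splits)
    have "vars_eqs E'' \<subseteq> vars_eqs E' \<union> set2_trm t - {x}"
      using sub by (fastforce simp: vars_eqs_def E''_def)
    with xE have "vars_eqs E'' \<subset> vars_eqs E"
      by auto
    then have "card (vars_eqs E'') < card (vars_eqs E)"
      by (intro psubset_card_mono) auto
    moreover have "unifies_eqs \<tau> E''"
      using uni \<delta>[of \<tau>] by (simp add: uni'' eq)
    ultimately obtain \<sigma> where \<sigma>: "is_mgu_eqs \<sigma> E''"
      using IH[of E'' \<tau>] by auto
    have t\<delta>: "subst_trm t \<delta> = t"
      using x by (subst subst_trm_cong[of t \<delta> Var]) (auto simp: \<delta>_def)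
    have "unifies_eqs (\<lambda>y. subst_trm (\<delta> y) \<sigma>) E"
      using \<sigma> t\<delta> by (simp add: is_mgu_eqs_def uni'' eq flip: subst_trm_subst_trm)
        (simp add: \<delta>_def)
    moreover have "\<exists>\<rho>. \<forall>y. \<upsilon> y = subst_trm (subst_trm (\<delta> y) \<sigma>) \<rho>" if "unifies_eqs \<upsilon> E" for \<upsilon>
    proof -
      have \<upsilon>: "\<upsilon> x = subst_trm t \<upsilon>" "unifies_eqs \<upsilon> E'"
        using that by (simp_all add: eq)
      then obtain \<rho> where "\<forall>y. \<upsilon> y = subst_trm (\<sigma> y) \<rho>"
        using \<sigma> \<delta>[OF \<upsilon>(1)] unfolding is_mgu_eqs_def uni'' by metis
      then have "(\<lambda>y. subst_trm (\<sigma> y) \<rho>) = \<upsilon>"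
        by auto
      then show ?thesis
        using \<delta>[OF \<upsilon>(1)] by (metis subst_trm_subst_trm)
    qed
    ultimately show ?thesis
      by (auto simp: is_mgu_eqs_def)
  qed
  have drop: "\<exists>\<sigma>. is_mgu_eqs \<sigma> E"
    if "vars_eqs E' \<subseteq> vars_eqs E"
      and "size_list (\<lambda>e. size (fst e)) E' < size_list (\<lambda>e. size (fst e)) E"
      and eq: "\<And>\<upsilon>. unifies_eqs \<upsilon> E \<longleftrightarrow> unifies_eqs \<upsilon> E'" for E'
  proof -
    have "card (vars_eqs E') \<le> card (vars_eqs E)"
      using that by (intro card_mono) auto
    then have "\<exists>\<sigma>. is_mgu_eqs \<sigma> E'"
      using IH[of E' \<tau>] uni that by (simp add: le_less)
    then show ?thesis
      using is_mgu_eqs_cong[OF eq] by blast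
  qed
  have var: "\<exists>\<sigma>. is_mgu_eqs \<sigma> E"
    if E: "E = (Var x, t) # E' \<or> E = (t, Var x) # E'" for x t E'
  proof (cases "x \<in> set2_trm t")
    case True
    then have "t = Var x"
      using occurs_check[of x t \<tau>] uni E by auto
    then show ?thesis
      using E by (intro drop[of E']) auto
  next
    case False
    then show ?thesis
      using E by (intro elim[of x t E']) auto
  qed
  show ?case
  proof (cases E)
    case Nil
    then have "is_mgu_eqs Var E"
      by (auto simp: is_mgu_eqs_def)
    then show ?thesis by blast
  next
    case (Cons e E')
    obtain s t where e: "e = (s, t)"
      by (cases e)
    show ?thesis
    proof (cases s)
      case (Var x)
      then show ?thesis using Cons e by (intro var[of x t E']) simp
    next
      case s: (Fun f ts)
      show ?thesis
      proof (cases t)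
        case (Var x)
        then show ?thesis using Cons e by (intro var[of x s E']) simp
      next
        case t: (Fun g us)
        \<comment> \<open>The unifier \<open>\<tau>\<close> rules out a clash of function symbols or
          arities, so \<open>zip\<close> truncates nothing.\<close>
        have fg: "f = g" and "map (\<lambda>t. subst_trm t \<tau>) ts = map (\<lambda>t. subst_trm t \<tau>) us"
          using uni by (simp_all add: Cons e s t)
        then have len: "length ts = length us"
          by (meson map_eq_imp_length_eq)
        show ?thesis
        proof (rule drop[of "zip ts us @ E'"])
          show "vars_eqs (zip ts us @ E') \<subseteq> vars_eqs E"
            using vars_eqs_zip_subset[of ts us] by (simp add: Cons e s t) blast
          show "size_list (\<lambda>e. size (fst e)) (zip ts us @ E') < size_list (\<lambda>e. size (fst e)) E"
            by (simp add: Cons e s size_list_zip_fst[OF len])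
          show "unifies_eqs \<upsilon> E \<longleftrightarrow> unifies_eqs \<upsilon> (zip ts us @ E')" for \<upsilon>
            by (simp add: Cons e s t fg unifies_eqs_zip[OF len])
        qed
      qed
    qed
  qed
qed

section \<open>Reduction of literal unification to term equations\<close>

lemma map_subst_trm_eq_iff:
  "map (\<lambda>t. subst_trm t \<sigma>) ts = map (\<lambda>t. subst_trm t \<sigma>) us \<longleftrightarrow>
     length ts = length us \<and> unifies_eqs \<sigma> (zip ts us)"
  using unifies_eqs_zip[of ts us \<sigma>] by (metis length_map)

text \<open>The part of a literal that no substitution changes. The arity belongs to it because
  \<open>zip\<close> would silently truncate argument lists of different length.\<close>

fun lit_head :: "('p, 'f, 'v) literal \<Rightarrow> bool \<times> 'p \<times> nat" where
  "lit_head (Pos (Atom p ts)) = (True, p, length ts)"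
| "lit_head (Neg (Atom p ts)) = (False, p, length ts)"

fun lit_args :: "('p, 'f, 'v) literal \<Rightarrow> ('f, 'v) trm list" where
  "lit_args (Pos (Atom p ts)) = ts"
| "lit_args (Neg (Atom p ts)) = ts"

lemma subst_lit_eq_iff:
  "subst_lit M \<sigma> = subst_lit M' \<sigma> \<longleftrightarrow>
     lit_head M = lit_head M' \<and> unifies_eqs \<sigma> (zip (lit_args M) (lit_args M'))"
  by (cases M rule: lit_head.cases; cases M' rule: lit_head.cases)
    (auto simp: map_subst_trm_eq_iff)

lemma exists_mgu:
  assumes "finite S" and "unifiable S"
  shows "\<exists>\<sigma>. is_mgu \<sigma> S"
proof (cases "S = {}")
  case True
  then have "is_mgu Var S"
    by (auto simp: is_mgu_def is_unifier_def)
  then show ?thesis by blast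
next
  case False
  then obtain M where M: "M \<in> S"
    by blast
  obtain Ms where Ms: "set Ms = S"
    using assms finite_list by blast
  \<comment> \<open>It suffices to equate one fixed member \<open>M\<close> with every member of
    \<open>S\<close>; finiteness of \<open>S\<close> makes this a list.\<close>
  define E where "E = concat (map (\<lambda>M'. zip (lit_args M) (lit_args M')) Ms)"
  obtain \<tau> where \<tau>: "is_unifier \<tau> S"
    using assms by (auto simp: unifiable_def)
  then have head: "\<forall>M' \<in> S. lit_head M = lit_head M'"
    using M by (meson is_unifier_def subst_lit_eq_iff)
  have E: "unifies_eqs \<sigma> E \<longleftrightarrow> (\<forall>M' \<in> S. unifies_eqs \<sigma> (zip (lit_args M) (lit_args M')))" for \<sigma>
    by (auto simp: E_def unifies_eqs_def simp flip: Ms)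
  have "is_unifier \<sigma> S \<longleftrightarrow> (\<forall>M' \<in> S. subst_lit M \<sigma> = subst_lit M' \<sigma>)" for \<sigma>
    using M unfolding is_unifier_def by metis
  then have eq: "is_unifier \<sigma> S \<longleftrightarrow> unifies_eqs \<sigma> E" for \<sigma>
    using head by (simp add: E subst_lit_eq_iff)
  then show ?thesis
    using exists_mgu_eqs[of \<tau> E] \<tau> by (simp add: is_mgu_def is_mgu_eqs_def)
qed

lemma is_mgu_selected:
  assumes "mgu_selection mgu" and "finite S" and "unifiable S"
  shows "is_mgu (mgu S) S"
  using assms exists_mgu[of S] by (simp add: mgu_selection_def)

section \<open>Polarities\<close>

fun is_pos :: "('p, 'f, 'v) literal \<Rightarrow> bool" where
  "is_pos (Pos A) = True"
| "is_pos (Neg A) = False"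

lemma is_pos_complement [simp]: "is_pos (complement M) \<longleftrightarrow> \<not> is_pos M"
  by (cases M) auto

lemma is_pos_subst_lit [simp]: "is_pos (subst_lit M \<sigma>) \<longleftrightarrow> is_pos M"
  by (cases M) auto

lemma complement_complement [simp]: "complement (complement M) = M"
  by (cases M) auto

lemma subst_lit_complement: "subst_lit (complement M) \<sigma> = complement (subst_lit M \<sigma>)"
  by (cases M) auto

lemma subst_lit_subst_lit: "subst_lit (subst_lit M \<sigma>) \<tau> = subst_lit M (\<lambda>x. subst_trm (\<sigma> x) \<tau>)"
  by (cases M rule: lit_head.cases) (auto simp: subst_trm_subst_trm)

lemma unifiable_complement_iff:
  "unifiable {M, complement L} \<longleftrightarrow> (\<exists>\<sigma>. subst_lit L \<sigma> = subst_lit (complement M) \<sigma>)"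
proof -
  have "is_unifier \<sigma> {M, complement L} \<longleftrightarrow> subst_lit L \<sigma> = subst_lit (complement M) \<sigma>" for \<sigma>
    by (auto simp: is_unifier_def subst_lit_complement)
      (metis complement_complement)+
  then show ?thesis by (simp add: unifiable_def)
qed

text \<open>Substitutions preserve polarity. This is what later separates the literals of
  \<open>Ns\<close> from the literals that they cancel against.\<close>

lemma unifiable_complement_polarity:
  "unifiable {M, complement L} \<Longrightarrow> is_pos M \<longleftrightarrow> \<not> is_pos L"
  by (metis unifiable_complement_iff is_pos_subst_lit is_pos_complement)

section \<open>The loops\<close>

locale resolution_partners =
  fixes mgu :: "('p, 'f, 'v) literal set \<Rightarrow> ('f, 'v) subst"
    and L :: "('p, 'f, 'v) literal"
    and C' D D' :: "('p, 'f, 'v) clause"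
    and Ns :: "('p, 'f, 'v) literal list"
  assumes mgu: "mgu_selection mgu"
    and D: "D = mset Ns + D'"
    and Ns: "\<forall>M \<in> set Ns. unifiable {M, complement L}"
    and D': "\<forall>M \<in># D'. \<not> unifiable {M, complement L}"
begin

abbreviation selected_mgu :: "('p, 'f, 'v) literal set \<Rightarrow> ('f, 'v) subst" where
  "selected_mgu N \<equiv> mgu (insert L (complement ` N))"

text \<open>All copies in \<open>D\<close> of each member of \<open>N\<close> are resolved away,
  whereas a general resolvent may keep some copies.\<close>

abbreviation resolvent_on :: "('p, 'f, 'v) literal set \<Rightarrow> ('p, 'f, 'v) clause" where
  "resolvent_on N \<equiv>
     subst_clause C' (selected_mgu N) + subst_clause {#M \<in># D. M \<notin> N#} (selected_mgu N)"

abbreviation pairs_on :: "('p, 'f, 'v) literal set \<Rightarrow> ('p, 'f, 'v) literal set set" where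
  "pairs_on N \<equiv> complementary_pairs (resolvent_on N)"

text \<open>The next value of the loop variable. If several members of \<open>Ns\<close> have the
  same instance in a pair, all of them are added.\<close>

abbreviation extension :: "('p, 'f, 'v) literal set \<Rightarrow> ('p, 'f, 'v) literal set" where
  "extension N \<equiv> N \<union> {M \<in> set Ns. \<exists>p \<in> pairs_on N. subst_lit M (selected_mgu N) \<in> p}"

section \<open>Unfolding, induction and termination of the while loop\<close>

lemma is_mgu_selected_mgu:
  assumes "N \<subseteq> set Ns" and "unifiable (insert L (complement ` N))"
  shows "is_mgu (selected_mgu N) (insert L (complement ` N))"
  using assms mgu by (intro is_mgu_selected) (auto dest: finite_subset)

lemma while_loop_cases:
  obtains (not_unifiable) "\<not> unifiable (insert L (complement ` N))"
      "while_loop mgu L C' Ns D N = Some Leave_Loop"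
  | (no_pairs) "unifiable (insert L (complement ` N))" "pairs_on N = {}"
      "while_loop mgu L C' Ns D N = Some Return_NO"
  | (extend) "unifiable (insert L (complement ` N))" "pairs_on N \<noteq> {}"
      "\<forall>p \<in> pairs_on N. \<exists>M \<in> set Ns - N. subst_lit M (selected_mgu N) \<in> p"
      "while_loop mgu L C' Ns D N = while_loop mgu L C' Ns D (extension N)"
  | (leave) "unifiable (insert L (complement ` N))" "pairs_on N \<noteq> {}"
      "\<not> (\<forall>p \<in> pairs_on N. \<exists>M \<in> set Ns - N. subst_lit M (selected_mgu N) \<in> p)"
      "while_loop mgu L C' Ns D N = Some Leave_Loop"
  using while_loop.simps[of mgu L C' Ns D N] unfolding Let_def by presburger

text \<open>Serves as the induction rule of the loop: the finite set of members of \<open>Ns\<close>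
  outside \<open>N\<close> shrinks. The hypothesis is guarded by strict growth, which has to be
  shown in the branch that recurses.\<close>

lemma while_loop_induct [consumes 1, case_names step]:
  assumes "N \<subseteq> set Ns"
    and step: "\<And>N. N \<subseteq> set Ns \<Longrightarrow>
      (N \<subset> extension N \<Longrightarrow> P (extension N)) \<Longrightarrow> P N"
  shows "P N"
  using assms(1)
proof (induction "card (set Ns - N)" arbitrary: N rule: less_induct)
  case less
  show ?case
  proof (rule step[OF less.prems])
    assume "N \<subset> extension N"
    moreover from this have "set Ns - extension N \<subset> set Ns - N"
      by blast
    then have "card (set Ns - extension N) < card (set Ns - N)"
      by (intro psubset_card_mono) auto
    ultimately show "P (extension N)"
      using less.prems by (intro less.hyps) auto
  qed
qed

lemma while_loop_terminates:
  assumes "N \<subseteq> set Ns"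
  shows "while_loop mgu L C' Ns D N \<noteq> None"
  using assms
proof (induction N rule: while_loop_induct)
  case (step N)
  show ?case
  proof (cases N rule: while_loop_cases)
    case extend
    \<comment> \<open>There is at least one pair, and the loop condition gives it a member that is
      an instance of a literal of \<open>Ns\<close> outside \<open>N\<close>.\<close>
    then have "N \<subset> extension N"
      by blast
    then show ?thesis using step(2) extend(4) by simp
  qed simp_all
qed

text \<open>The set \<open>N\<close> at which the loop stops supplies the resolvent. It is still
  nonempty because the loop only enlarges it.\<close>

lemma Return_NO_imp_invalid_resolvent:
  assumes "N \<subseteq> set Ns" and "N \<noteq> {}" and "while_loop mgu L C' Ns D N = Some Return_NO"
  shows "\<exists>R. L_resolvent L (add_mset L C') D R \<and> \<not> valid R"
  using assms
proof (induction N rule: while_loop_induct)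
  case (step N)
  show ?case
  proof (cases N rule: while_loop_cases)
    case no_pairs
    \<comment> \<open>The resolved part is the multiset of all copies in \<open>D\<close> of members
      of \<open>N\<close>. Its support is \<open>N\<close>, so the selected unifier is the one that
      \<open>L_resolvent\<close> asks for.\<close>
    have "set_mset {#M \<in># D. M \<in> N#} = N"
      using step(1) D by auto
    moreover from this have "{#M \<in># D. M \<in> N#} \<noteq> {#}"
      using step(3) by (metis set_mset_empty)
    moreover have "D = {#M \<in># D. M \<in> N#} + {#M \<in># D. M \<notin> N#}"
      by (rule multiset_partition)
    ultimately have "L_resolvent L (add_mset L C') D (resolvent_on N)"
      unfolding L_resolvent_def
      using is_mgu_selected_mgu[OF step(1) no_pairs(1)] by metis
    moreover have "\<not> valid (resolvent_on N)"
      using no_pairs(2) by (auto simp: valid_iff_complementary_pair complementary_pairs_def)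
    ultimately show ?thesis by blast
  next
    case extend
    then have "N \<subset> extension N"
      by blast
    then show ?thesis using step(2-4) extend(4) by auto
  qed (use step in simp_all)
qed

section \<open>Invalid resolvents force the answer NO\<close>

lemma resolved_literals_subset:
  assumes "D = M + D''" and "is_unifier \<tau> (insert L (complement ` set_mset M))"
  shows "set_mset M \<subseteq> set Ns"
proof
  fix A assume A: "A \<in># M"
  then have "unifiable {A, complement L}"
    using assms(2) by (auto simp: unifiable_complement_iff is_unifier_def)
  with A assms(1) show "A \<in> set Ns"
    using D D' by (metis set_mset_mset union_iff)
qed

text \<open>The inclusion of \<open>N\<close> in \<open>M\<close> is the loop invariant. It excludes
  both ways of leaving the loop: \<open>\<tau>\<close> witnesses unifiability, and each pair
  contains an instance of a literal of \<open>Ns\<close> outside \<open>N\<close>.\<close>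

lemma invalid_resolvent_imp_Return_NO:
  assumes split: "D = M + D''"
    and \<tau>: "is_unifier \<tau> (insert L (complement ` set_mset M))"
    and inv: "\<not> valid (subst_clause C' \<tau> + subst_clause D'' \<tau>)"
    and N: "N \<subseteq> set_mset M"
  shows "while_loop mgu L C' Ns D N = Some Return_NO"
proof -
  have sub: "set_mset M \<subseteq> set Ns"
    using resolved_literals_subset[OF split \<tau>] .
  with N have "N \<subseteq> set Ns" by blast
  then show ?thesis
    using N
  proof (induction N rule: while_loop_induct)
    case (step N)
    let ?\<sigma> = "selected_mgu N"
    have \<tau>N: "is_unifier \<tau> (insert L (complement ` N))"
      using \<tau> step(3) by (auto simp: is_unifier_def)
    then have unif: "unifiable (insert L (complement ` N))"
      by (auto simp: unifiable_def)
    \<comment> \<open>\<open>\<tau>\<close> unifies the smaller set belonging to \<open>N\<close>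
      too, hence is an instance of its most general unifier; complementarity under
      \<open>?\<sigma>\<close> therefore persists under \<open>\<tau>\<close>.\<close>
    obtain \<rho> where "\<forall>x. \<tau> x = subst_trm (?\<sigma> x) \<rho>"
      using is_mgu_selected_mgu[OF step(1) unif] \<tau>N by (auto simp: is_mgu_def)
    then have factor: "subst_lit A \<tau> = subst_lit (subst_lit A ?\<sigma>) \<rho>" for A
      by (simp add: subst_lit_subst_lit flip: fun_eq_iff)
    have pair: "subst_lit A \<tau> \<noteq> complement (subst_lit B \<tau>)"
      if "A \<in># C' + D''" "B \<in># C' + D''" for A B
      using inv that by (auto simp: valid_iff_complementary_pair subst_clause_def)
    have polarity: "is_pos A \<longleftrightarrow> \<not> is_pos L" if "A \<in> set Ns" for A
      using that Ns unifiable_complement_polarity by blast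
    \<comment> \<open>Let \<open>B\<close> be the member with the polarity of \<open>L\<close>. It
      cannot come from \<open>M\<close>, so it survives in \<open>C' + D''\<close>. Then
      \<open>A\<close> cannot survive there as well, so it comes from \<open>M\<close> and is not
      yet in \<open>N\<close>.\<close>
    have blocked: "\<exists>A B. A \<in> set Ns - N \<and> B \<in># C' + D'' \<and> is_pos B = is_pos L \<and>
        p = {subst_lit A ?\<sigma>, subst_lit B ?\<sigma>} \<and>
        subst_lit A ?\<sigma> = complement (subst_lit B ?\<sigma>)" if "p \<in> pairs_on N" for p
    proof -
      obtain A B where AB: "A \<in># C' + {#M \<in># D. M \<notin> N#}" "B \<in># C' + {#M \<in># D. M \<notin> N#}"
        and p: "p = {subst_lit A ?\<sigma>, subst_lit B ?\<sigma>}"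
        and comp: "subst_lit A ?\<sigma> = complement (subst_lit B ?\<sigma>)"
        and pos: "is_pos B = is_pos L"
      proof -
        obtain X where X: "X \<in># resolvent_on N" "complement X \<in># resolvent_on N"
          "p = {X, complement X}"
          using \<open>p \<in> pairs_on N\<close> by (auto simp: complementary_pairs_def)
        obtain A B where *: "A \<in># C' + {#M \<in># D. M \<notin> N#}" "B \<in># C' + {#M \<in># D. M \<notin> N#}"
          "X = subst_lit A ?\<sigma>" "complement X = subst_lit B ?\<sigma>"
          using X(1,2) by (force simp: subst_clause_def)
        have "is_pos B \<longleftrightarrow> \<not> is_pos A"
          using *(3,4) by (metis is_pos_subst_lit is_pos_complement)
        \<comment> \<open>The two members have opposite polarities, so after a swap if necessary
          \<open>B\<close> is the one that agrees with \<open>L\<close>.\<close>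
        then consider "is_pos B = is_pos L" | "is_pos A = is_pos L" by blast
        then show thesis
        proof cases
          case 1
          show thesis
            by (rule that[of A B]) (use * X(3) 1 in \<open>auto simp flip: *(4)\<close>)
        next
          case 2
          show thesis
            by (rule that[of B A]) (use * X(3) 2 in auto)
        qed
      qed
      have "B \<notin># M"
        using pos polarity sub by blast
      then have B: "B \<in># C' + D''"
        using AB split by auto
      have "subst_lit A \<tau> = complement (subst_lit B \<tau>)"
        using comp by (simp add: factor subst_lit_complement)
      then have "A \<notin># C' + D''"
        using pair B by blast
      then have "A \<in> set Ns - N"
        using AB split sub by auto
      with B pos p comp show ?thesis by blast
    qed
    have ext: "extension N \<subseteq> set_mset M"
    proof
      fix A assume A: "A \<in> extension N"
      show "A \<in># M"
      proof (cases "A \<in> N")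
        case False
        with A obtain p where Ns: "A \<in> set Ns" and p: "p \<in> pairs_on N" "subst_lit A ?\<sigma> \<in> p"
          by blast
        obtain A' B where B: "B \<in># C' + D''" "is_pos B = is_pos L"
          "p = {subst_lit A' ?\<sigma>, subst_lit B ?\<sigma>}"
          "subst_lit A' ?\<sigma> = complement (subst_lit B ?\<sigma>)"
          using blocked[OF p(1)] by blast
        \<comment> \<open>The literal \<open>A'\<close> that witnesses blocking may differ from the
          added \<open>A\<close>. Polarity still puts the instance of \<open>A\<close> on the side
          of \<open>A'\<close>, opposite to \<open>B\<close>, so \<open>A\<close> cannot remain in
          \<open>D''\<close> either.\<close>
        have "subst_lit A ?\<sigma> \<noteq> subst_lit B ?\<sigma>"
          using polarity[OF Ns] B(2) by (metis is_pos_subst_lit)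
        then have "subst_lit A ?\<sigma> = complement (subst_lit B ?\<sigma>)"
          using p(2) B(3,4) by auto
        then have "subst_lit A \<tau> = complement (subst_lit B \<tau>)"
          by (simp add: factor subst_lit_complement)
        then have "A \<notin># D''"
          using pair B(1) by auto
        moreover have "A \<in># D"
          using Ns D by simp
        ultimately show ?thesis
          using split by simp
      qed (use step(3) in blast)
    qed
    show ?case
    proof (cases N rule: while_loop_cases)
      case extend
      then have "N \<subset> extension N"
        by blast
      then show ?thesis using step(2) ext extend(4) by simp
    next
      case leave
      then show ?thesis using blocked by blast
    qed (use unif in simp_all)
  qed
qed

section \<open>From the while loop to the whole procedure\<close>

text \<open>Termination of each while loop excludes \<open>None\<close>, so only an answer NO can
  prevent the for loop from reaching the end of its list.\<close>

lemma for_loop_YES_iff: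
  assumes "set Ms \<subseteq> set Ns"
  shows "for_loop mgu L C' Ns D Ms = Some YES \<longleftrightarrow>
    (\<forall>M \<in> set Ms. while_loop mgu L C' Ns D {M} \<noteq> Some Return_NO)"
  using assms
proof (induction Ms)
  case (Cons M Ms)
  then show ?case
    using while_loop_terminates[of "{M}"]
    by (auto split: option.split loop_exit.split)
qed simp

lemma procedure_YES_iff:
  "procedure mgu L C' Ns D = Some YES \<longleftrightarrow>
     (\<forall>R. L_resolvent L (add_mset L C') D R \<longrightarrow> valid R)"
proof -
  have "\<exists>A \<in> set Ns. while_loop mgu L C' Ns D {A} = Some Return_NO"
    if R: "L_resolvent L (add_mset L C') D R" "\<not> valid R" for R
  proof -
    obtain M D'' \<tau> where *: "D = M + D''" "M \<noteq> {#}"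
      "is_mgu \<tau> (insert L (complement ` set_mset M))"
      "R = subst_clause C' \<tau> + subst_clause D'' \<tau>"
      using R(1) by (auto simp: L_resolvent_def)
    then have \<tau>: "is_unifier \<tau> (insert L (complement ` set_mset M))"
      by (simp add: is_mgu_def)
    \<comment> \<open>Any member of \<open>M\<close> serves as the starting literal: it lies in
      \<open>Ns\<close>, so the for loop tries it, and its singleton satisfies the
      invariant.\<close>
    obtain A where A: "A \<in># M"
      using *(2) by blast
    then have "A \<in> set Ns"
      using resolved_literals_subset[OF *(1) \<tau>] by blast
    then show ?thesis
      using invalid_resolvent_imp_Return_NO[OF *(1) \<tau>, of "{A}"] R(2) *(4) A by auto
  qed
  moreover have "\<exists>R. L_resolvent L (add_mset L C') D R \<and> \<not> valid R"
    if "A \<in> set Ns" "while_loop mgu L C' Ns D {A} = Some Return_NO" for A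
    using Return_NO_imp_invalid_resolvent[of "{A}"] that by simp
  ultimately show ?thesis
    unfolding procedure_def for_loop_YES_iff[OF subset_refl] by blast
qed

end

theorem theorem5:
  fixes mgu :: "('p, 'f, 'v) literal set \<Rightarrow> ('f, 'v) subst"
    and L :: "('p, 'f, 'v) literal"
    and C C' D D' :: "('p, 'f, 'v) clause"
    and Ns :: "('p, 'f, 'v) literal list"
  assumes "mgu_selection mgu"
    and "C = add_mset L C'"
    and "D = mset Ns + D'"
    and "\<forall>M \<in> set Ns. unifiable {M, complement L}"
    and "\<forall>M \<in># D'. \<not> unifiable {M, complement L}"
    and "vars_clause C \<inter> vars_clause D = {}"
  shows "procedure mgu L C' Ns D = Some YES \<longleftrightarrow> (\<forall>R. L_resolvent L C D R \<longrightarrow> valid R)"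
proof -
  interpret resolution_partners mgu L C' D D' Ns
    using assms by unfold_locales
  show ?thesis
    using procedure_YES_iff assms(2) by simp
qed

end
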